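(* Let $R$ be a noetherian ring and let $T$ be any multiplicatively closed subset of $R$. Then $i(T^{-1}R)\leq i(R)$.
   Context: All rings are commutative with identity. For an ideal $J$ of a noetherian ring $R$, an element $x\in R$ is integral over $J$ if $x^n+a_1x^{n-1}+\cdots+a_n=0$ for some $n\geq 1$ and $a_i\in J^i$ ($1\le i\le n$); the integral closure $\overline{J}$ is the ideal of all elements integral over $J$. The integral dimension $i(R)$ of a noetherian ring $R$ is the least integer $k\geq 0$ such that $(\overline{J})^n\subseteq J^{n-k}$ for all ideals $J$ of $R$ and all $n\geq k$ (with $J^0=R$), if such a $k$ exists; otherwise $i(R)=\infty$. The inequality is understood in $\mathbb{Z}_{\geq 0}\cup\{\infty\}$. *)

theory Defs
  imports "HOL-Algebra.Algebra" "HOL-Library.Extended_Nat"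
begin

text \<open>
  Powers of ideals are powers in the semiring \<^const>\<open>ideals_set\<close> of ideals of \<open>R\<close>: multiplication
  is \<^const>\<open>ideal_prod\<close> and the unit is \<open>carrier R\<close>, so the zeroth power of an ideal is the whole ring.
\<close>

definition integral_over :: "('a, 'b) ring_scheme \<Rightarrow> 'a set \<Rightarrow> 'a \<Rightarrow> bool" where
  "integral_over R J x \<longleftrightarrow> x \<in> carrier R \<and>
     (\<exists>n::nat. n \<ge> 1 \<and> (\<exists>a::nat \<Rightarrow> 'a.
        (\<forall>i\<in>{1..n}. a i \<in> J [^]\<^bsub>ideals_set R\<^esub> i) \<and>
        x [^]\<^bsub>R\<^esub> n \<oplus>\<^bsub>R\<^esub> (\<Oplus>\<^bsub>R\<^esub>i\<in>{1..n}. a i \<otimes>\<^bsub>R\<^esub> x [^]\<^bsub>R\<^esub> (n - i)) = \<zero>\<^bsub>R\<^esub>))"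

definition integral_closure :: "('a, 'b) ring_scheme \<Rightarrow> 'a set \<Rightarrow> 'a set" where
  "integral_closure R J = {x. integral_over R J x}"

definition integral_dim_bound :: "('a, 'b) ring_scheme \<Rightarrow> nat \<Rightarrow> bool" where
  "integral_dim_bound R k \<longleftrightarrow>
     (\<forall>J n. ideal J R \<longrightarrow> n \<ge> k \<longrightarrow>
        integral_closure R J [^]\<^bsub>ideals_set R\<^esub> n \<subseteq> J [^]\<^bsub>ideals_set R\<^esub> (n - k))"

definition integral_dim :: "('a, 'b) ring_scheme \<Rightarrow> enat" where
  "integral_dim R =
     (if \<exists>k. integral_dim_bound R k then enat (LEAST k. integral_dim_bound R k) else \<infinity>)"

text \<open>
  The ring of fractions of \<open>R\<close> with denominators in a submonoid \<open>T\<close> of the multiplicative monoid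
  of \<open>R\<close>. A fraction is an equivalence class of pairs (numerator, denominator). Zero divisors, and
  even zero, are allowed in \<open>T\<close>, hence the factor \<open>u\<close> in the equivalence.
\<close>

definition frac_rel :: "('a, 'b) ring_scheme \<Rightarrow> 'a set \<Rightarrow> (('a \<times> 'a) \<times> ('a \<times> 'a)) set" where
  "frac_rel R T =
     {((a, s), (b, t)) | a s b t.
        a \<in> carrier R \<and> s \<in> T \<and> b \<in> carrier R \<and> t \<in> T \<and>
        (\<exists>u\<in>T. u \<otimes>\<^bsub>R\<^esub> (t \<otimes>\<^bsub>R\<^esub> a \<ominus>\<^bsub>R\<^esub> s \<otimes>\<^bsub>R\<^esub> b) = \<zero>\<^bsub>R\<^esub>)}"

definition fraction :: "('a, 'b) ring_scheme \<Rightarrow> 'a set \<Rightarrow> 'a \<Rightarrow> 'a \<Rightarrow> ('a \<times> 'a) set" where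
  "fraction R T a s = frac_rel R T `` {(a, s)}"

text \<open>
  The unions below range over all representatives; since the operations are well defined on
  classes, all members of such a union coincide.
\<close>

definition localization :: "('a, 'b) ring_scheme \<Rightarrow> 'a set \<Rightarrow> ('a \<times> 'a) set ring" where
  "localization R T =
     \<lparr> carrier = (carrier R \<times> T) // frac_rel R T,
       monoid.mult = (\<lambda>P Q. \<Union>p\<in>P. \<Union>q\<in>Q.
                fraction R T (fst p \<otimes>\<^bsub>R\<^esub> fst q) (snd p \<otimes>\<^bsub>R\<^esub> snd q)),
       one = fraction R T \<one>\<^bsub>R\<^esub> \<one>\<^bsub>R\<^esub>,
       ring.zero = fraction R T \<zero>\<^bsub>R\<^esub> \<one>\<^bsub>R\<^esub>,
       add = (\<lambda>P Q. \<Union>p\<in>P. \<Union>q\<in>Q.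
                fraction R T (snd q \<otimes>\<^bsub>R\<^esub> fst p \<oplus>\<^bsub>R\<^esub> snd p \<otimes>\<^bsub>R\<^esub> fst q)
                  (snd p \<otimes>\<^bsub>R\<^esub> snd q)) \<rparr>"

end

theory Submission
  imports Defs
begin

text \<open>
  Let \<open>S = T\<^sup>-\<^sup>1R\<close>, with canonical map \<open>h\<close>. Let \<open>J\<close> be an ideal of \<open>S\<close> and \<open>I\<close> its contraction to \<open>R\<close>.
  It suffices that every \<open>k\<close> bounding the integral closures of powers in \<open>R\<close> also does so in \<open>S\<close>, and
  this follows by clearing denominators: every element of \<open>S\<close> is associated to an element of \<open>h(R)\<close>,
  through a unit \<open>h(t)\<close> with \<open>t\<close> in \<open>T\<close>.

  The crucial case is an element \<open>x\<close> of the integral closure of \<open>J\<close>. Choose a common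
  denominator \<open>u\<close> of \<open>x\<close> and of the coefficients of its equation, and multiply the equation by
  \<open>u\<^sup>n\<close>, where \<open>n\<close> is its degree. The result is the image under \<open>h\<close> of an equation over \<open>I\<close> for some
  \<open>a\<close> in \<open>R\<close> with \<open>h(a) = h(u)x\<close>. That equation holds in \<open>R\<close> only up to some \<open>v\<close> in \<open>T\<close>, but
  multiplying by \<open>v\<^sup>n\<close> turns it into a true equation for \<open>va\<close>. So \<open>vu\<close> carries \<open>x\<close> into the image of
  the integral closure of \<open>I\<close> (lemma \<open>clear_integral_closure\<close>).

  Clearing denominators is compatible with products and sums, hence with powers (lemma
  \<open>clear_ideal_pow\<close>): an element \<open>x\<close> of the \<open>n\<close>-th power of the integral closure of \<open>J\<close> has a
  multiple \<open>h(t)x = h(b)\<close> with \<open>b\<close> in the \<open>n\<close>-th power of the integral closure of \<open>I\<close>. The bound for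
  \<open>R\<close> puts \<open>b\<close> into \<open>I\<^sup>n\<^sup>-\<^sup>k\<close>, so \<open>h(b)\<close> lies in \<open>J\<^sup>n\<^sup>-\<^sup>k\<close>, and so does \<open>x\<close>, since \<open>h(t)\<close> is a unit.

  The argument uses only that \<open>h\<close> is a homomorphism with three properties, collected in the locale \<open>ring_of_fractions\<close>; the
  concrete ring of fractions is then shown to have them.
\<close>

section \<open>Powers of ideals\<close>

lemma ideals_set_one [simp]: "\<one>\<^bsub>ideals_set R\<^esub> = carrier R"
  by (simp add: ideals_set_def)

lemma ideals_set_mult [simp]: "I \<otimes>\<^bsub>ideals_set R\<^esub> J = I \<cdot>\<^bsub>R\<^esub> J"
  by (simp add: ideals_set_def)

lemma ideal_pow_0: "J [^]\<^bsub>ideals_set R\<^esub> (0::nat) = carrier R"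
  by (simp add: nat_pow_def)

lemma ideal_pow_Suc: "J [^]\<^bsub>ideals_set R\<^esub> Suc n = (J [^]\<^bsub>ideals_set R\<^esub> n) \<cdot>\<^bsub>R\<^esub> J"
  by (simp add: nat_pow_def)

context cring
begin

text \<open>
  The next two lemmas concern arbitrary subsets \<open>B\<close>. They can thus be applied to an integral closure
  without first proving that it is an ideal. Absorption holds even so: the zeroth power is the
  whole ring, and a scalar can always be moved into the leftmost factor of a product.
\<close>

lemma ideal_pow_closed:
  assumes "B \<subseteq> carrier R"
  shows "B [^]\<^bsub>ideals_set R\<^esub> (n::nat) \<subseteq> carrier R"
proof (induction n)
  case (Suc n)
  have "x \<in> carrier R" if "x \<in> (B [^]\<^bsub>ideals_set R\<^esub> n) \<cdot> B" for x
    using that by induction (use Suc assms in auto)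
  then show ?case by (auto simp: ideal_pow_Suc)
qed (simp add: ideal_pow_0)

lemma ideal_pow_absorbs:
  assumes "B \<subseteq> carrier R" "r \<in> carrier R" "x \<in> B [^]\<^bsub>ideals_set R\<^esub> (n::nat)"
  shows "r \<otimes> x \<in> B [^]\<^bsub>ideals_set R\<^esub> n"
  using assms(3)
proof (induction n arbitrary: x)
  case (Suc n)
  have sub: "B [^]\<^bsub>ideals_set R\<^esub> n \<subseteq> carrier R" "(B [^]\<^bsub>ideals_set R\<^esub> n) \<cdot> B \<subseteq> carrier R"
    using ideal_pow_closed[OF assms(1), of n] ideal_pow_closed[OF assms(1), of "Suc n"]
    by (auto simp: ideal_pow_Suc)
  from Suc.prems have "x \<in> (B [^]\<^bsub>ideals_set R\<^esub> n) \<cdot> B" by (simp add: ideal_pow_Suc)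
  then have "r \<otimes> x \<in> (B [^]\<^bsub>ideals_set R\<^esub> n) \<cdot> B"
  proof induction
    case (prod i j)
    then have "(r \<otimes> i) \<otimes> j \<in> (B [^]\<^bsub>ideals_set R\<^esub> n) \<cdot> B"
      by (intro ideal_prod.prod Suc.IH)
    moreover have "i \<in> carrier R" "j \<in> carrier R" using prod sub assms(1) by auto
    ultimately show ?case using assms(2) by (simp add: m_assoc)
  next
    case (sum x y)
    then have "r \<otimes> x \<oplus> r \<otimes> y \<in> (B [^]\<^bsub>ideals_set R\<^esub> n) \<cdot> B"
      by (intro ideal_prod.sum)
    moreover have "x \<in> carrier R" "y \<in> carrier R" using sum sub by auto
    ultimately show ?case using assms(2) by (simp add: r_distr)
  qed
  then show ?case by (simp add: ideal_pow_Suc)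
qed (use assms in \<open>simp add: ideal_pow_0\<close>)

text \<open>
  Multiplying an equation of degree \<open>n\<close> for \<open>x\<close> by \<open>u\<^sup>n\<close> gives an equation for \<open>ux\<close>. It serves twice:
  in the ring of fractions to clear denominators, and in \<open>R\<close> to remove \<open>T\<close>-torsion.
\<close>

lemma integral_equation_scale:
  assumes u: "u \<in> carrier R" and x: "x \<in> carrier R" and a: "a \<in> {1..n} \<rightarrow> carrier R"
  shows "u [^] n \<otimes> (x [^] n \<oplus> (\<Oplus>i\<in>{1..n::nat}. a i \<otimes> x [^] (n - i)))
       = (u \<otimes> x) [^] n \<oplus> (\<Oplus>i\<in>{1..n}. (u [^] i \<otimes> a i) \<otimes> (u \<otimes> x) [^] (n - i))"
proof -
  have "u [^] n \<otimes> (a i \<otimes> x [^] (n - i)) = (u [^] i \<otimes> a i) \<otimes> (u \<otimes> x) [^] (n - i)"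
    if i: "i \<in> {1..n}" for i
  proof -
    have ai: "a i \<in> carrier R" using a i by auto
    have "u [^] n = u [^] i \<otimes> u [^] (n - i)"
      using i u by (simp add: nat_pow_mult)
    then show ?thesis using u x ai by (simp add: nat_pow_distrib m_ac)
  qed
  then have "(\<Oplus>i\<in>{1..n}. u [^] n \<otimes> (a i \<otimes> x [^] (n - i)))
      = (\<Oplus>i\<in>{1..n}. (u [^] i \<otimes> a i) \<otimes> (u \<otimes> x) [^] (n - i))"
    by (intro finsum_cong') (use u x a in \<open>auto simp: Pi_iff\<close>)
  moreover have "u [^] n \<otimes> (\<Oplus>i\<in>{1..n}. a i \<otimes> x [^] (n - i))
      = (\<Oplus>i\<in>{1..n}. u [^] n \<otimes> (a i \<otimes> x [^] (n - i)))"
    by (rule finsum_rdistr) (use u x a in \<open>auto simp: Pi_iff\<close>)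
  moreover have "(\<Oplus>i\<in>{1..n}. a i \<otimes> x [^] (n - i)) \<in> carrier R"
    by (rule finsum_closed) (use x a in \<open>auto simp: Pi_iff\<close>)
  ultimately show ?thesis using u x by (simp add: r_distr nat_pow_distrib)
qed

end


section \<open>Rings of fractions\<close>

text \<open>
  These three properties characterize \<open>T\<^sup>-\<^sup>1R\<close> up to isomorphism, so the arguments below need no
  equivalence classes. ``\<open>t\<close> clears \<open>x\<close> into \<open>B\<close>'' is expressed by \<open>h t \<otimes>\<^bsub>S\<^esub> x \<in> h ` B\<close>.
\<close>

locale ring_of_fractions = ring_hom_cring R S h + T: submonoid T R
  for R (structure) and S (structure) and h and T +
  assumes denominator_unit: "t \<in> T \<Longrightarrow> h t \<in> Units S"
    and denominator_exists: "x \<in> carrier S \<Longrightarrow> \<exists>t\<in>T. h t \<otimes>\<^bsub>S\<^esub> x \<in> h ` carrier R"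
    and kernel_torsion: "a \<in> carrier R \<Longrightarrow> h a = \<zero>\<^bsub>S\<^esub> \<Longrightarrow> \<exists>t\<in>T. t \<otimes> a = \<zero>"
begin

lemma denominator_carrier: "t \<in> T \<Longrightarrow> t \<in> carrier R"
  using T.subset by auto

lemma clear_by_multiple:
  assumes "s \<in> T" "t \<in> T" "x \<in> carrier S" "h t \<otimes>\<^bsub>S\<^esub> x \<in> h ` B"
    and "B \<subseteq> carrier R" "\<And>r b. r \<in> carrier R \<Longrightarrow> b \<in> B \<Longrightarrow> r \<otimes> b \<in> B"
  shows "h (s \<otimes> t) \<otimes>\<^bsub>S\<^esub> x \<in> h ` B"
proof -
  obtain b where b: "b \<in> B" "h t \<otimes>\<^bsub>S\<^esub> x = h b" using assms by auto
  have "h (s \<otimes> t) \<otimes>\<^bsub>S\<^esub> x = h (s \<otimes> b)"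
    using assms b denominator_carrier by (simp add: S.m_assoc subset_iff)
  then show ?thesis using assms b denominator_carrier by blast
qed

lemma common_denominator:
  assumes "finite F" "\<And>i. i \<in> F \<Longrightarrow> x i \<in> carrier S"
    and "\<And>i. i \<in> F \<Longrightarrow> \<exists>t\<in>T. h t \<otimes>\<^bsub>S\<^esub> x i \<in> h ` B i"
    and "\<And>i. i \<in> F \<Longrightarrow> B i \<subseteq> carrier R"
    and "\<And>i r b. i \<in> F \<Longrightarrow> r \<in> carrier R \<Longrightarrow> b \<in> B i \<Longrightarrow> r \<otimes> b \<in> B i"
  shows "\<exists>t\<in>T. \<forall>i\<in>F. h t \<otimes>\<^bsub>S\<^esub> x i \<in> h ` B i"
  using assms
proof (induction F)
  case empty
  then show ?case using T.one_closed by blast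
next
  case (insert j F)
  then obtain t where t: "t \<in> T" "\<forall>i\<in>F. h t \<otimes>\<^bsub>S\<^esub> x i \<in> h ` B i" by auto
  obtain s where s: "s \<in> T" "h s \<otimes>\<^bsub>S\<^esub> x j \<in> h ` B j" using insert.prems(2) by blast
  have "h (s \<otimes> t) \<otimes>\<^bsub>S\<^esub> x i \<in> h ` B i" if "i \<in> F" for i
    by (rule clear_by_multiple) (use that insert.prems s t in auto)
  moreover have "h (t \<otimes> s) \<otimes>\<^bsub>S\<^esub> x j \<in> h ` B j"
    by (rule clear_by_multiple) (use insert.prems s t in auto)
  moreover have "t \<otimes> s = s \<otimes> t" using s t denominator_carrier by (simp add: R.m_comm)
  ultimately show ?case using s t T.m_closed by (metis insert_iff)
qed

text \<open>
  A product is cleared by the product of the denominators of its factors, and a sum by a common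
  denominator. The latter requires the powers of \<open>B\<close> to absorb multiplication by \<open>R\<close>.
\<close>

lemma clear_ideal_pow:
  assumes A: "A \<subseteq> carrier S" and B: "B \<subseteq> carrier R"
    and AB: "\<And>x. x \<in> A \<Longrightarrow> \<exists>t\<in>T. h t \<otimes>\<^bsub>S\<^esub> x \<in> h ` B"
    and "x \<in> A [^]\<^bsub>ideals_set S\<^esub> (n::nat)"
  shows "\<exists>t\<in>T. h t \<otimes>\<^bsub>S\<^esub> x \<in> h ` (B [^]\<^bsub>ideals_set R\<^esub> n)"
  using assms(4)
proof (induction n arbitrary: x)
  case 0
  then show ?case using denominator_exists by (simp add: ideal_pow_0)
next
  case (Suc n)
  let ?An = "A [^]\<^bsub>ideals_set S\<^esub> n" and ?Bn = "B [^]\<^bsub>ideals_set R\<^esub> n"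
  have subS: "?An \<subseteq> carrier S" "?An \<cdot>\<^bsub>S\<^esub> A \<subseteq> carrier S"
    using S.ideal_pow_closed[OF A, of n] S.ideal_pow_closed[OF A, of "Suc n"]
    by (auto simp: ideal_pow_Suc)
  have subR: "?Bn \<subseteq> carrier R" "?Bn \<cdot> B \<subseteq> carrier R"
    using R.ideal_pow_closed[OF B, of n] R.ideal_pow_closed[OF B, of "Suc n"]
    by (auto simp: ideal_pow_Suc)
  have absorb: "r \<otimes> b \<in> ?Bn \<cdot> B" if "r \<in> carrier R" "b \<in> ?Bn \<cdot> B" for r b
    using R.ideal_pow_absorbs[OF B, of r b "Suc n"] that by (simp add: ideal_pow_Suc)
  from Suc.prems have "x \<in> ?An \<cdot>\<^bsub>S\<^esub> A" by (simp add: ideal_pow_Suc)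
  then have "\<exists>t\<in>T. h t \<otimes>\<^bsub>S\<^esub> x \<in> h ` (?Bn \<cdot> B)"
  proof induction
    case (prod i j)
    obtain s c where s: "s \<in> T" "c \<in> ?Bn" "h s \<otimes>\<^bsub>S\<^esub> i = h c" using Suc.IH prod by blast
    obtain t d where t: "t \<in> T" "d \<in> B" "h t \<otimes>\<^bsub>S\<^esub> j = h d" using AB prod by blast
    have carr: "s \<in> carrier R" "t \<in> carrier R" "c \<in> carrier R" "d \<in> carrier R"
      "i \<in> carrier S" "j \<in> carrier S"
      using s t subR subS prod A B denominator_carrier by auto
    have "h (s \<otimes> t) \<otimes>\<^bsub>S\<^esub> (i \<otimes>\<^bsub>S\<^esub> j) = (h s \<otimes>\<^bsub>S\<^esub> i) \<otimes>\<^bsub>S\<^esub> (h t \<otimes>\<^bsub>S\<^esub> j)"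
      using carr by (simp add: S.m_ac)
    also have "\<dots> = h (c \<otimes> d)" using s t carr by simp
    finally have "h (s \<otimes> t) \<otimes>\<^bsub>S\<^esub> (i \<otimes>\<^bsub>S\<^esub> j) = h (c \<otimes> d)" .
    moreover have "c \<otimes> d \<in> ?Bn \<cdot> B" using s t by (intro ideal_prod.prod)
    moreover have "s \<otimes> t \<in> T" using s t by simp
    ultimately show ?case by blast
  next
    case (sum y z)
    have yz: "y \<in> carrier S" "z \<in> carrier S" using sum subS by auto
    obtain t where t: "t \<in> T" "\<forall>v\<in>{y, z}. h t \<otimes>\<^bsub>S\<^esub> v \<in> h ` (?Bn \<cdot> B)"
      using common_denominator[of "{y, z}" "\<lambda>v. v" "\<lambda>_. ?Bn \<cdot> B"] sum yz subR absorb by auto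
    then obtain c d where cd: "c \<in> ?Bn \<cdot> B" "h t \<otimes>\<^bsub>S\<^esub> y = h c" "d \<in> ?Bn \<cdot> B" "h t \<otimes>\<^bsub>S\<^esub> z = h d"
      by auto
    have "h t \<otimes>\<^bsub>S\<^esub> (y \<oplus>\<^bsub>S\<^esub> z) = h (c \<oplus> d)"
      using cd yz t subR denominator_carrier by (simp add: S.r_distr subset_iff)
    moreover have "c \<oplus> d \<in> ?Bn \<cdot> B" using cd by (intro ideal_prod.sum)
    ultimately show ?case using t by blast
  qed
  then show ?case by (simp add: ideal_pow_Suc)
qed

lemma hom_ideal_pow:
  assumes "B \<subseteq> carrier R" "h ` B \<subseteq> A"
  shows "h ` (B [^]\<^bsub>ideals_set R\<^esub> (n::nat)) \<subseteq> A [^]\<^bsub>ideals_set S\<^esub> n"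
proof (induction n)
  case 0
  then show ?case by (auto simp: ideal_pow_0)
next
  case (Suc n)
  let ?An = "A [^]\<^bsub>ideals_set S\<^esub> n" and ?Bn = "B [^]\<^bsub>ideals_set R\<^esub> n"
  have subR: "?Bn \<subseteq> carrier R" "?Bn \<cdot> B \<subseteq> carrier R"
    using R.ideal_pow_closed[OF assms(1), of n] R.ideal_pow_closed[OF assms(1), of "Suc n"]
    by (auto simp: ideal_pow_Suc)
  have "h b \<in> ?An \<cdot>\<^bsub>S\<^esub> A" if "b \<in> ?Bn \<cdot> B" for b
    using that
  proof induction
    case (prod i j)
    then have "h i \<otimes>\<^bsub>S\<^esub> h j \<in> ?An \<cdot>\<^bsub>S\<^esub> A"
      by (intro ideal_prod.prod) (use Suc.IH assms in auto)
    moreover have "h (i \<otimes> j) = h i \<otimes>\<^bsub>S\<^esub> h j" using prod subR assms by (intro hom_mult) auto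
    ultimately show ?case by simp
  next
    case (sum y z)
    then have "h y \<oplus>\<^bsub>S\<^esub> h z \<in> ?An \<cdot>\<^bsub>S\<^esub> A" by (intro ideal_prod.sum)
    moreover have "h (y \<oplus> z) = h y \<oplus>\<^bsub>S\<^esub> h z" using sum subR by (intro hom_add) auto
    ultimately show ?case by simp
  qed
  then show ?case by (auto simp: ideal_pow_Suc)
qed

lemma unit_denominator_cancel:
  assumes "t \<in> T" "x \<in> carrier S"
  shows "inv\<^bsub>S\<^esub> (h t) \<otimes>\<^bsub>S\<^esub> (h t \<otimes>\<^bsub>S\<^esub> x) = x"
  using denominator_unit[OF assms(1)] assms(2) by (simp add: S.Units_closed S.m_assoc[symmetric])

definition contraction :: "'c set \<Rightarrow> 'a set" where
  "contraction J = {a \<in> carrier R. h a \<in> J}"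

lemma contraction_ideal: "ideal J S \<Longrightarrow> ideal (contraction J) R"
  unfolding contraction_def by (rule ring.ideal_vimage)

lemma contraction_carrier: "contraction J \<subseteq> carrier R"
  by (auto simp: contraction_def)

lemma clear_contraction:
  assumes "ideal J S" "x \<in> J"
  shows "\<exists>t\<in>T. h t \<otimes>\<^bsub>S\<^esub> x \<in> h ` contraction J"
proof -
  have "x \<in> carrier S" using assms by (rule ideal.Icarr)
  then obtain t a where t: "t \<in> T" "a \<in> carrier R" "h t \<otimes>\<^bsub>S\<^esub> x = h a"
    using denominator_exists by blast
  moreover have "h t \<otimes>\<^bsub>S\<^esub> x \<in> J"
    by (rule ideal.I_l_closed) (use assms t denominator_carrier in auto)
  ultimately have "a \<in> contraction J" by (auto simp: contraction_def)
  then show ?thesis using t by blast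
qed

text \<open>
  Scaling an integral equation of \<open>x\<close> by a common denominator moves it to \<open>R\<close>. Since
  \<open>clear_ideal_pow\<close> clears the \<open>i\<close>-th coefficient into the \<open>i\<close>-th power of the contraction, the
  result is again an equation of integral dependence, up to \<open>T\<close>-torsion.
\<close>

lemma clear_integral_closure:
  assumes J: "ideal J S" and x: "x \<in> integral_closure S J"
  shows "\<exists>t\<in>T. h t \<otimes>\<^bsub>S\<^esub> x \<in> h ` integral_closure R (contraction J)"
proof -
  let ?I = "contraction J"
  have I: "?I [^]\<^bsub>ideals_set R\<^esub> i \<subseteq> carrier R" for i :: nat
    by (intro R.ideal_pow_closed contraction_carrier)
  have absorb: "r \<otimes> c \<in> ?I [^]\<^bsub>ideals_set R\<^esub> i"
    if "r \<in> carrier R" "c \<in> ?I [^]\<^bsub>ideals_set R\<^esub> i" for r c and i :: nat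
    using that by (intro R.ideal_pow_absorbs contraction_carrier)
  have Jc: "J \<subseteq> carrier S" using ideal.Icarr[OF J] by blast
  from x obtain n :: nat and \<alpha> where xS: "x \<in> carrier S" and n: "n \<ge> 1"
    and \<alpha>: "\<forall>i\<in>{1..n}. \<alpha> i \<in> J [^]\<^bsub>ideals_set S\<^esub> i"
    and eq: "x [^]\<^bsub>S\<^esub> n \<oplus>\<^bsub>S\<^esub> (\<Oplus>\<^bsub>S\<^esub>i\<in>{1..n}. \<alpha> i \<otimes>\<^bsub>S\<^esub> x [^]\<^bsub>S\<^esub> (n - i)) = \<zero>\<^bsub>S\<^esub>"
    unfolding integral_closure_def integral_over_def mem_Collect_eq by blast
  have \<alpha>S: "\<alpha> i \<in> carrier S" if "i \<in> {1..n}" for i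
    using \<alpha> that S.ideal_pow_closed[OF Jc] by blast
  have "\<exists>t\<in>T. h t \<otimes>\<^bsub>S\<^esub> \<alpha> i \<in> h ` (?I [^]\<^bsub>ideals_set R\<^esub> i)" if "i \<in> {1..n}" for i
    by (rule clear_ideal_pow[OF Jc contraction_carrier])
      (use J \<alpha> that clear_contraction in auto)
  then obtain t where t: "t \<in> T" "\<forall>i\<in>{1..n}. h t \<otimes>\<^bsub>S\<^esub> \<alpha> i \<in> h ` (?I [^]\<^bsub>ideals_set R\<^esub> i)"
    using common_denominator[of "{1..n}" \<alpha> "\<lambda>i. ?I [^]\<^bsub>ideals_set R\<^esub> i"] \<alpha>S I absorb by auto
  obtain s where s: "s \<in> T" "h s \<otimes>\<^bsub>S\<^esub> x \<in> h ` carrier R" using denominator_exists xS by blast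
  define u where "u = s \<otimes> t"
  have u: "u \<in> T" "u \<in> carrier R" using s t denominator_carrier by (auto simp: u_def)
  have ua: "h u \<otimes>\<^bsub>S\<^esub> \<alpha> i \<in> h ` (?I [^]\<^bsub>ideals_set R\<^esub> i)" if "i \<in> {1..n}" for i
    unfolding u_def by (rule clear_by_multiple) (use s t that \<alpha>S I absorb in auto)
  have "u = t \<otimes> s" using s t denominator_carrier by (simp add: u_def R.m_comm)
  then have "h u \<otimes>\<^bsub>S\<^esub> x \<in> h ` carrier R"
    using clear_by_multiple[of t s x "carrier R"] s t xS by auto
  then obtain a where a: "a \<in> carrier R" "h u \<otimes>\<^bsub>S\<^esub> x = h a" by auto
  have "\<forall>i\<in>{1..n}. \<exists>c. c \<in> ?I [^]\<^bsub>ideals_set R\<^esub> i \<and> h u \<otimes>\<^bsub>S\<^esub> \<alpha> i = h c"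
    using ua by blast
  from bchoice[OF this] obtain c where c: "\<And>i. i \<in> {1..n} \<Longrightarrow> c i \<in> ?I [^]\<^bsub>ideals_set R\<^esub> i"
      "\<And>i. i \<in> {1..n} \<Longrightarrow> h u \<otimes>\<^bsub>S\<^esub> \<alpha> i = h (c i)"
    by blast
  \<comment> \<open>Scaling the equation by \<open>h u\<close> multiplies the \<open>i\<close>-th coefficient by \<open>h u\<close> to the power \<open>i\<close>. One
    of these factors clears its denominator, so only \<open>i - 1\<close> of them remain over \<open>R\<close>.\<close>
  define d where "d i = u [^] (i - 1) \<otimes> c i" for i
  have d: "d i \<in> ?I [^]\<^bsub>ideals_set R\<^esub> i" if "i \<in> {1..n}" for i
    unfolding d_def using absorb c that u by simp
  have dR: "d i \<in> carrier R" if "i \<in> {1..n}" for i using d that I by blast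
  have hd: "h (d i) = h u [^]\<^bsub>S\<^esub> i \<otimes>\<^bsub>S\<^esub> \<alpha> i" if i: "i \<in> {1..n}" for i
  proof -
    have ci: "c i \<in> carrier R" using c i I by blast
    have "h (d i) = h u [^]\<^bsub>S\<^esub> (i - 1) \<otimes>\<^bsub>S\<^esub> (h u \<otimes>\<^bsub>S\<^esub> \<alpha> i)"
      using c(2)[OF i] u ci by (simp add: d_def ring.hom_nat_pow)
    also have "\<dots> = h u [^]\<^bsub>S\<^esub> Suc (i - 1) \<otimes>\<^bsub>S\<^esub> \<alpha> i"
      using u \<alpha>S[OF i] by (simp add: S.m_assoc)
    also have "Suc (i - 1) = i" using i by simp
    finally show ?thesis .
  qed
  define p where "p = a [^] n \<oplus> (\<Oplus>i\<in>{1..n}. d i \<otimes> a [^] (n - i))"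
  have sumR: "(\<Oplus>i\<in>{1..n}. d i \<otimes> a [^] (n - i)) \<in> carrier R"
    by (rule R.finsum_closed) (use dR a in auto)
  then have p: "p \<in> carrier R" using a by (simp add: p_def)
  have "h p = h a [^]\<^bsub>S\<^esub> n \<oplus>\<^bsub>S\<^esub> (\<Oplus>\<^bsub>S\<^esub>i\<in>{1..n}. h (d i) \<otimes>\<^bsub>S\<^esub> h a [^]\<^bsub>S\<^esub> (n - i))"
  proof -
    have "h (\<Oplus>i\<in>{1..n}. d i \<otimes> a [^] (n - i))
        = (\<Oplus>\<^bsub>S\<^esub>i\<in>{1..n}. (h \<circ> (\<lambda>i. d i \<otimes> a [^] (n - i))) i)"
      by (rule hom_finsum) (use dR a in auto)
    also have "\<dots> = (\<Oplus>\<^bsub>S\<^esub>i\<in>{1..n}. h (d i) \<otimes>\<^bsub>S\<^esub> h a [^]\<^bsub>S\<^esub> (n - i))"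
      by (rule S.finsum_cong') (use dR a in \<open>auto simp: ring.hom_nat_pow\<close>)
    finally show ?thesis using sumR a by (simp add: p_def ring.hom_nat_pow)
  qed
  also have "(\<Oplus>\<^bsub>S\<^esub>i\<in>{1..n}. h (d i) \<otimes>\<^bsub>S\<^esub> h a [^]\<^bsub>S\<^esub> (n - i))
      = (\<Oplus>\<^bsub>S\<^esub>i\<in>{1..n}. (h u [^]\<^bsub>S\<^esub> i \<otimes>\<^bsub>S\<^esub> \<alpha> i) \<otimes>\<^bsub>S\<^esub> (h u \<otimes>\<^bsub>S\<^esub> x) [^]\<^bsub>S\<^esub> (n - i))"
    by (rule S.finsum_cong') (use hd a u xS \<alpha>S in auto)
  also have "h a [^]\<^bsub>S\<^esub> n \<oplus>\<^bsub>S\<^esub> \<dots> = h u [^]\<^bsub>S\<^esub> n \<otimes>\<^bsub>S\<^esub>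
      (x [^]\<^bsub>S\<^esub> n \<oplus>\<^bsub>S\<^esub> (\<Oplus>\<^bsub>S\<^esub>i\<in>{1..n}. \<alpha> i \<otimes>\<^bsub>S\<^esub> x [^]\<^bsub>S\<^esub> (n - i)))"
    unfolding a(2)[symmetric]
    by (rule S.integral_equation_scale[symmetric]) (use u xS \<alpha>S in auto)
  also have "\<dots> = \<zero>\<^bsub>S\<^esub>" using eq u by simp
  finally obtain v where v: "v \<in> T" "v \<otimes> p = \<zero>" using kernel_torsion[OF p] by auto
  have vR: "v \<in> carrier R" using v denominator_carrier by blast
  \<comment> \<open>Killing \<open>p\<close> by \<open>v\<close> alone would leave \<open>v\<close> as leading coefficient; with the \<open>n\<close>-th power of \<open>v\<close>
    the equation becomes monic in \<open>v \<otimes> a\<close>.\<close>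
  have "v [^] n \<otimes> p = v [^] (n - 1) \<otimes> (v \<otimes> p)"
    using n vR p by (metis One_nat_def R.m_assoc R.nat_pow_Suc R.nat_pow_closed Suc_pred
        less_eq_Suc_le)
  also have "\<dots> = \<zero>" using v vR by simp
  finally have "(v \<otimes> a) [^] n \<oplus> (\<Oplus>i\<in>{1..n}. (v [^] i \<otimes> d i) \<otimes> (v \<otimes> a) [^] (n - i)) = \<zero>"
    unfolding p_def using R.integral_equation_scale[of v a d n] vR a dR by auto
  then have "v \<otimes> a \<in> integral_closure R ?I"
    unfolding integral_closure_def integral_over_def mem_Collect_eq
    using vR a n d absorb by (intro conjI exI[of _ n] exI[of _ "\<lambda>i. v [^] i \<otimes> d i"]) auto
  moreover have "h (v \<otimes> u) \<otimes>\<^bsub>S\<^esub> x = h (v \<otimes> a)"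
    using a u vR xS by (simp add: S.m_assoc)
  moreover have "v \<otimes> u \<in> T" using u v by simp
  ultimately show ?thesis by blast
qed

lemma integral_closure_carrier: "integral_closure Q J \<subseteq> carrier Q"
  by (auto simp: integral_closure_def integral_over_def)

lemma integral_dim_bound_fractions:
  assumes k: "integral_dim_bound R k"
  shows "integral_dim_bound S k"
  unfolding integral_dim_bound_def
proof (intro allI impI subsetI)
  fix J n x
  assume J: "ideal J S" and n: "n \<ge> k" and x: "x \<in> integral_closure S J [^]\<^bsub>ideals_set S\<^esub> n"
  have Jc: "J \<subseteq> carrier S" using ideal.Icarr[OF J] by blast
  have xS: "x \<in> carrier S" using x S.ideal_pow_closed[OF integral_closure_carrier] by blast
  obtain t b where t: "t \<in> T" "h t \<otimes>\<^bsub>S\<^esub> x = h b"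
    and b: "b \<in> integral_closure R (contraction J) [^]\<^bsub>ideals_set R\<^esub> n"
    using clear_ideal_pow[OF integral_closure_carrier integral_closure_carrier
        clear_integral_closure[OF J] x] by blast
  have "b \<in> contraction J [^]\<^bsub>ideals_set R\<^esub> (n - k)"
    using k contraction_ideal[OF J] n b unfolding integral_dim_bound_def by blast
  then have "h b \<in> J [^]\<^bsub>ideals_set S\<^esub> (n - k)"
    using hom_ideal_pow[OF contraction_carrier, of J J "n - k"] by (auto simp: contraction_def)
  then have "inv\<^bsub>S\<^esub> (h t) \<otimes>\<^bsub>S\<^esub> (h t \<otimes>\<^bsub>S\<^esub> x) \<in> J [^]\<^bsub>ideals_set S\<^esub> (n - k)"
    unfolding t(2) by (rule S.ideal_pow_absorbs[OF Jc, rotated])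
      (use denominator_unit[OF t(1)] in simp)
  then show "x \<in> J [^]\<^bsub>ideals_set S\<^esub> (n - k)"
    using unit_denominator_cancel[OF t(1) xS] by simp
qed

lemma integral_dim_fractions: "integral_dim S \<le> integral_dim R"
proof (cases "\<exists>k. integral_dim_bound R k")
  case True
  then have "integral_dim_bound R (LEAST k. integral_dim_bound R k)" by (rule LeastI_ex)
  then have S: "integral_dim_bound S (LEAST k. integral_dim_bound R k)"
    by (rule integral_dim_bound_fractions)
  then have "(LEAST k. integral_dim_bound S k) \<le> (LEAST k. integral_dim_bound R k)"
    by (rule Least_le)
  moreover have "\<exists>k. integral_dim_bound S k" using S by (rule exI)
  ultimately show ?thesis using True by (simp only: integral_dim_def if_True enat_ord_simps)
qed (simp add: integral_dim_def)

end


section \<open>The localization is a ring of fractions\<close>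

locale denominators = cring R + T: submonoid T R for R (structure) and T
begin

lemma T_carrier [simp]: "t \<in> T \<Longrightarrow> t \<in> carrier R"
  using T.subset by auto

text \<open>
  Without subtraction, the equivalence of fractions can be handled by associativity and
  commutativity of the product alone.
\<close>

lemma frac_rel_iff:
  "((a, s), (b, t)) \<in> frac_rel R T \<longleftrightarrow> a \<in> carrier R \<and> s \<in> T \<and> b \<in> carrier R \<and> t \<in> T \<and>
     (\<exists>u\<in>T. u \<otimes> (t \<otimes> a) = u \<otimes> (s \<otimes> b))"
proof -
  have "u \<otimes> (t \<otimes> a \<ominus> s \<otimes> b) = \<zero> \<longleftrightarrow> u \<otimes> (t \<otimes> a) = u \<otimes> (s \<otimes> b)"
    if "a \<in> carrier R" "s \<in> T" "b \<in> carrier R" "t \<in> T" "u \<in> T" for u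
  proof -
    have "u \<otimes> (t \<otimes> a \<ominus> s \<otimes> b) = u \<otimes> (t \<otimes> a) \<ominus> u \<otimes> (s \<otimes> b)"
      using that by (simp add: minus_eq r_distr r_minus)
    then show ?thesis using that by simp
  qed
  then show ?thesis unfolding frac_rel_def by (simp cong: conj_cong bex_cong)
qed

lemma equiv_frac_rel: "equiv (carrier R \<times> T) (frac_rel R T)"
proof (rule equivI)
  show "frac_rel R T \<subseteq> (carrier R \<times> T) \<times> (carrier R \<times> T)" by (auto simp: frac_rel_def)
  show "refl_on (carrier R \<times> T) (frac_rel R T)"
    by (rule refl_onI) (auto simp: frac_rel_iff intro: T.one_closed)
  show "sym (frac_rel R T)"
    by (rule symI) (auto simp: frac_rel_iff, metis)
  show "trans (frac_rel R T)"
  proof (rule transI, clarify)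
    fix a s b t c w
    assume "((a, s), (b, t)) \<in> frac_rel R T" "((b, t), (c, w)) \<in> frac_rel R T"
    then obtain u v where c: "a \<in> carrier R" "s \<in> T" "b \<in> carrier R" "t \<in> T" "c \<in> carrier R"
        "w \<in> T" "u \<in> T" "v \<in> T"
      and e: "u \<otimes> (t \<otimes> a) = u \<otimes> (s \<otimes> b)" "v \<otimes> (w \<otimes> b) = v \<otimes> (t \<otimes> c)"
      by (auto simp: frac_rel_iff)
    \<comment> \<open>The middle denominator \<open>t\<close> cannot be cancelled, so it joins the torsion factor.\<close>
    have "(u \<otimes> v \<otimes> t) \<otimes> (w \<otimes> a) = v \<otimes> w \<otimes> (u \<otimes> (t \<otimes> a))" using c by (simp add: m_ac)
    also have "\<dots> = u \<otimes> s \<otimes> (v \<otimes> (w \<otimes> b))" unfolding e(1) using c by (simp add: m_ac)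
    also have "\<dots> = (u \<otimes> v \<otimes> t) \<otimes> (s \<otimes> c)" unfolding e(2) using c by (simp add: m_ac)
    finally show "((a, s), (c, w)) \<in> frac_rel R T"
      unfolding frac_rel_iff using c by (blast intro: T.m_closed)
  qed
qed

lemma fraction_eq_iff:
  assumes "a \<in> carrier R" "s \<in> T" "b \<in> carrier R" "t \<in> T"
  shows "fraction R T a s = fraction R T b t \<longleftrightarrow> (\<exists>u\<in>T. u \<otimes> (t \<otimes> a) = u \<otimes> (s \<otimes> b))"
  unfolding fraction_def using assms
  by (subst eq_equiv_class_iff[OF equiv_frac_rel]) (auto simp: frac_rel_iff)

lemma fraction_expand:
  assumes "a \<in> carrier R" "s \<in> T" "w \<in> T"
  shows "fraction R T (w \<otimes> a) (w \<otimes> s) = fraction R T a s"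
  by (subst fraction_eq_iff) (use assms in \<open>auto simp: m_ac intro: T.one_closed\<close>)

lemma fraction_carrier [simp]:
  "a \<in> carrier R \<Longrightarrow> s \<in> T \<Longrightarrow> fraction R T a s \<in> carrier (localization R T)"
  by (auto simp: localization_def fraction_def intro!: quotientI)

lemma localization_cases [consumes 1]:
  assumes "x \<in> carrier (localization R T)"
  obtains a s where "a \<in> carrier R" "s \<in> T" "x = fraction R T a s"
  using assms by (auto simp: localization_def fraction_def elim!: quotientE)

lemma localization_one [simp]: "\<one>\<^bsub>localization R T\<^esub> = fraction R T \<one> \<one>"
  by (simp add: localization_def)

lemma localization_zero [simp]: "\<zero>\<^bsub>localization R T\<^esub> = fraction R T \<zero> \<one>"
  by (simp add: localization_def)

lemma fraction_mult [simp]: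
  assumes "a \<in> carrier R" "s \<in> T" "b \<in> carrier R" "t \<in> T"
  shows "fraction R T a s \<otimes>\<^bsub>localization R T\<^esub> fraction R T b t = fraction R T (a \<otimes> b) (s \<otimes> t)"
proof -
  have "congruent2 (frac_rel R T) (frac_rel R T)
      (\<lambda>p q. fraction R T (fst p \<otimes> fst q) (snd p \<otimes> snd q))"
  proof (rule congruent2I', clarify)
    fix a s a' s' b t b' t'
    assume "((a, s), (a', s')) \<in> frac_rel R T" "((b, t), (b', t')) \<in> frac_rel R T"
    then obtain u v where c: "a \<in> carrier R" "s \<in> T" "a' \<in> carrier R" "s' \<in> T" "b \<in> carrier R"
        "t \<in> T" "b' \<in> carrier R" "t' \<in> T" "u \<in> T" "v \<in> T"
      and e: "u \<otimes> (s' \<otimes> a) = u \<otimes> (s \<otimes> a')" "v \<otimes> (t' \<otimes> b) = v \<otimes> (t \<otimes> b')"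
      by (auto simp: frac_rel_iff)
    have "(u \<otimes> v) \<otimes> ((s' \<otimes> t') \<otimes> (a \<otimes> b)) = (u \<otimes> (s' \<otimes> a)) \<otimes> (v \<otimes> (t' \<otimes> b))"
      using c by (simp add: m_ac)
    also have "\<dots> = (u \<otimes> v) \<otimes> ((s \<otimes> t) \<otimes> (a' \<otimes> b'))" unfolding e using c by (simp add: m_ac)
    finally have "fraction R T (a \<otimes> b) (s \<otimes> t) = fraction R T (a' \<otimes> b') (s' \<otimes> t')"
      using c by (subst fraction_eq_iff) (auto intro: T.m_closed)
    then show "fraction R T (fst (a, s) \<otimes> fst (b, t)) (snd (a, s) \<otimes> snd (b, t))
        = fraction R T (fst (a', s') \<otimes> fst (b', t')) (snd (a', s') \<otimes> snd (b', t'))" by simp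
  qed
  from UN_equiv_class2[OF equiv_frac_rel equiv_frac_rel this, of "(a, s)" "(b, t)"] assms
  show ?thesis by (simp add: localization_def fraction_def[of R T a s] fraction_def[of R T b t])
qed

lemma fraction_add [simp]:
  assumes "a \<in> carrier R" "s \<in> T" "b \<in> carrier R" "t \<in> T"
  shows "fraction R T a s \<oplus>\<^bsub>localization R T\<^esub> fraction R T b t
       = fraction R T (t \<otimes> a \<oplus> s \<otimes> b) (s \<otimes> t)"
proof -
  have "congruent2 (frac_rel R T) (frac_rel R T)
      (\<lambda>p q. fraction R T (snd q \<otimes> fst p \<oplus> snd p \<otimes> fst q) (snd p \<otimes> snd q))"
  proof (rule congruent2I', clarify)
    fix a s a' s' b t b' t'
    assume "((a, s), (a', s')) \<in> frac_rel R T" "((b, t), (b', t')) \<in> frac_rel R T"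
    then obtain u v where c: "a \<in> carrier R" "s \<in> T" "a' \<in> carrier R" "s' \<in> T" "b \<in> carrier R"
        "t \<in> T" "b' \<in> carrier R" "t' \<in> T" "u \<in> T" "v \<in> T"
      and e: "u \<otimes> (s' \<otimes> a) = u \<otimes> (s \<otimes> a')" "v \<otimes> (t' \<otimes> b) = v \<otimes> (t \<otimes> b')"
      by (auto simp: frac_rel_iff)
    have "(u \<otimes> v) \<otimes> ((s' \<otimes> t') \<otimes> (t \<otimes> a \<oplus> s \<otimes> b))
        = (v \<otimes> t' \<otimes> t) \<otimes> (u \<otimes> (s' \<otimes> a)) \<oplus> (u \<otimes> s' \<otimes> s) \<otimes> (v \<otimes> (t' \<otimes> b))"
      using c by (simp add: m_ac r_distr)
    also have "\<dots> = (u \<otimes> v) \<otimes> ((s \<otimes> t) \<otimes> (t' \<otimes> a' \<oplus> s' \<otimes> b'))"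
      unfolding e using c by (simp add: m_ac r_distr)
    finally have "fraction R T (t \<otimes> a \<oplus> s \<otimes> b) (s \<otimes> t)
        = fraction R T (t' \<otimes> a' \<oplus> s' \<otimes> b') (s' \<otimes> t')"
      using c by (subst fraction_eq_iff) (auto intro: T.m_closed)
    then show "fraction R T (snd (b, t) \<otimes> fst (a, s) \<oplus> snd (a, s) \<otimes> fst (b, t))
          (snd (a, s) \<otimes> snd (b, t))
        = fraction R T (snd (b', t') \<otimes> fst (a', s') \<oplus> snd (a', s') \<otimes> fst (b', t'))
          (snd (a', s') \<otimes> snd (b', t'))" by simp
  qed
  from UN_equiv_class2[OF equiv_frac_rel equiv_frac_rel this, of "(a, s)" "(b, t)"] assms
  show ?thesis by (simp add: localization_def fraction_def[of R T a s] fraction_def[of R T b t])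
qed

lemma fraction_zero: "s \<in> T \<Longrightarrow> fraction R T \<zero> s = fraction R T \<zero> \<one>"
  by (subst fraction_eq_iff) (auto intro: T.one_closed)

lemma localization_cring: "cring (localization R T)"
proof (rule cringI)
  show "abelian_group (localization R T)"
  proof (rule abelian_groupI)
    fix x assume "x \<in> carrier (localization R T)"
    then show "\<exists>y\<in>carrier (localization R T). y \<oplus>\<^bsub>localization R T\<^esub> x = \<zero>\<^bsub>localization R T\<^esub>"
    proof (cases rule: localization_cases)
      case (1 a s)
      have "fraction R T (\<ominus> a) s \<oplus>\<^bsub>localization R T\<^esub> x = \<zero>\<^bsub>localization R T\<^esub>"
        using 1
        by (simp add: r_minus l_neg fraction_zero[of "s \<otimes> s"])
      moreover have "fraction R T (\<ominus> a) s \<in> carrier (localization R T)" using 1 by simp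
      ultimately show ?thesis by (rule bexI)
    qed
  qed (auto elim!: localization_cases simp: m_ac a_ac r_distr)
  show "comm_monoid (localization R T)"
    by (rule comm_monoidI) (auto elim!: localization_cases simp: m_ac)
next
  fix x y z
  assume "x \<in> carrier (localization R T)" "y \<in> carrier (localization R T)"
    "z \<in> carrier (localization R T)"
  then obtain a s b t c w where c: "a \<in> carrier R" "s \<in> T" "b \<in> carrier R" "t \<in> T"
      "c \<in> carrier R" "w \<in> T"
    and e: "x = fraction R T a s" "y = fraction R T b t" "z = fraction R T c w"
    by (metis localization_cases)
  \<comment> \<open>Expanding \<open>xz + yz\<close> introduces the denominator \<open>w\<close> of \<open>z\<close> twice, so this law, unlike
    associativity and commutativity, needs a cancellation.\<close>
  have "x \<otimes>\<^bsub>localization R T\<^esub> z \<oplus>\<^bsub>localization R T\<^esub> y \<otimes>\<^bsub>localization R T\<^esub> z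
      = fraction R T (w \<otimes> ((t \<otimes> a \<oplus> s \<otimes> b) \<otimes> c)) (w \<otimes> (s \<otimes> t \<otimes> w))"
    using c by (simp add: e m_ac r_distr l_distr)
  also have "\<dots> = fraction R T ((t \<otimes> a \<oplus> s \<otimes> b) \<otimes> c) (s \<otimes> t \<otimes> w)"
    using c by (intro fraction_expand) auto
  also have "\<dots> = (x \<oplus>\<^bsub>localization R T\<^esub> y) \<otimes>\<^bsub>localization R T\<^esub> z"
    using c by (simp add: e)
  finally show "(x \<oplus>\<^bsub>localization R T\<^esub> y) \<otimes>\<^bsub>localization R T\<^esub> z =
      x \<otimes>\<^bsub>localization R T\<^esub> z \<oplus>\<^bsub>localization R T\<^esub> y \<otimes>\<^bsub>localization R T\<^esub> z" ..
qed

lemma localization_ring_of_fractions: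
  "ring_of_fractions R (localization R T) (\<lambda>a. fraction R T a \<one>) T"
proof -
  interpret L: cring "localization R T" by (rule localization_cring)
  have hom: "(\<lambda>a. fraction R T a \<one>) \<in> ring_hom R (localization R T)"
    by (rule ring_hom_memI) auto
  have cancel: "fraction R T s \<one> \<otimes>\<^bsub>localization R T\<^esub> fraction R T a s = fraction R T a \<one>"
    if "a \<in> carrier R" "s \<in> T" for a s
    using that fraction_expand[of a \<one> s] by simp
  show ?thesis
  proof
    show "(\<lambda>a. fraction R T a \<one>) \<in> ring_hom R (localization R T)" by (rule hom)
  next
    fix t assume t: "t \<in> T"
    have "fraction R T t \<one> \<otimes>\<^bsub>localization R T\<^esub> fraction R T \<one> t = \<one>\<^bsub>localization R T\<^esub>"
      using cancel[of \<one> t] t by simp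
    moreover have "fraction R T t \<one> \<in> carrier (localization R T)"
      "fraction R T \<one> t \<in> carrier (localization R T)" using t by auto
    ultimately show "fraction R T t \<one> \<in> Units (localization R T)"
      unfolding Units_def by (metis (mono_tags, lifting) L.m_comm mem_Collect_eq)
  next
    fix x assume "x \<in> carrier (localization R T)"
    then show "\<exists>t\<in>T. fraction R T t \<one> \<otimes>\<^bsub>localization R T\<^esub> x \<in> (\<lambda>a. fraction R T a \<one>) ` carrier R"
      by (cases rule: localization_cases) (use cancel in blast)
  next
    fix a assume "a \<in> carrier R" "fraction R T a \<one> = \<zero>\<^bsub>localization R T\<^esub>"
    then show "\<exists>t\<in>T. t \<otimes> a = \<zero>"
      by (auto simp: fraction_eq_iff)
  qed
qed

end

theorem corollary2p3:
  fixes R :: "('a, 'b) ring_scheme" and T :: "'a set"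
  assumes "cring R" and "noetherian_ring R"
    and "submonoid T R"
  shows "integral_dim (localization R T) \<le> integral_dim R"
proof -
  interpret denominators R T
    using assms by (simp add: denominators_def)
  interpret ring_of_fractions R "localization R T" "\<lambda>a. fraction R T a \<one>\<^bsub>R\<^esub>" T
    by (rule localization_ring_of_fractions)
  show ?thesis by (rule integral_dim_fractions)
qed

end
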